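(* Let $\sigma\in(0,1)$ and let $p\in P$. Let $K_2$ and $L$ be the optimal gains for the auxiliary system $$\dot x=A(p_0)x+Bu_2+\alpha(I-BB^{+})v,\qquad u_2=K_2x,\quad v=Lx,$$ minimizing the cost $$J_u=\int_0^\infty\left(x^{T}(F_u+\rho^2H+\beta^2I)x+u_2^{T}u_2+\rho^2v^{T}v\right)dt,$$ that is, $K_2=-B^{T}\hat S$ and $L=-\alpha\rho^{-2}(I-BB^{+})\hat S$, where $\hat S=\hat S^T>0$ solves $$\hat SA(p_0)+A(p_0)^{T}\hat S+F_u+\rho^2H+\beta^2I-\hat S\left(BB^{T}+\alpha^2\rho^{-2}(I-BB^{+})^2\right)\hat S=0 .$$ Suppose that $Q_2:=\beta^2I-2\rho^2L^{T}L>0$, and put $$\mu_2=\frac{\sigma\lambda_{\min}(Q_2)}{2\|\hat SBK_2\|}.$$ Then the unmatched uncertain event-triggered system $$\begin{aligned}\dot x={}&A(p_0)x+BK_2(x+e)+\alpha(I-BB^{+})L(x+e)+BB^{+}(A(p)-A(p_0))x\\&+(I-BB^{+})(A(p)-A(p_0))x-\alpha(I-BB^{+})L(x+e),\end{aligned}$$ that is, $\dot x(t)=A(p)x(t)+Bu_2(t_k)$ with the event-based control law $u_2(t_k)=K_2x(t_k)$ held on $[t_k,t_{k+1})$, is input-to-state stable (ISS) with respect to the measurement error $e$ if the event instants $\{t_k\}$ are given by $$t_0=0,\qquad t_{k+1}=\inf\{t\in\mathbb R : t>t_k\ \wedge\ \mu_2\|x(t)\|-\|e(t)\|\le0\}.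$$
   Context: Uncertain system: $\dot x=A(p)x+Bu$, $x\in\mathbb R^n$, $u\in\mathbb R^m$, where $p\in P$ is an uncertain parameter vector and $p_0$ is the known nominal parameter. $B^{+}=(B^{T}B)^{-1}B^{T}$ is the pseudo-inverse of $B$ ($B$ has full column rank). The uncertainty $A(p)-A(p_0)$ need not lie in the range of $B$. The scalars $\alpha>0$, $\rho\neq0$, $\beta$ are design parameters, and $F_u>0$, $H>0$ are symmetric matrices such that for all $p\in P$ $$(A(p)-A(p_0))^{T}(B^{+})^{T}B^{+}(A(p)-A(p_0))\le F_u,\qquad \alpha^{-2}(A(p)-A(p_0))^{T}(A(p)-A(p_0))\le H .$$ It is assumed that $\hat SBK_2\ne0$, so that $\mu_2$ is defined. Measurement error: $e(t)=x(t_k)-x(t)$ for $t\in[t_k,t_{k+1})$, $k\in\{0,1,2,\dots\}$. Here $\|\cdot\|$ is the Euclidean norm (induced norm for matrices), and $\lambda_{\min}$ is the smallest eigenvalue of a symmetric matrix. ISS: a system with state $x$ and input $d$ is called ISS with respect to $d$ if it has an ISS Lyapunov function, i.e. a function $V:\mathbb R^n\to\mathbb R$ for which there exist class $K_\infty$ functions $\alpha_1,\alpha_2,\alpha_3,\gamma$ such that for all $x,d\in\mathbb R^n$: $\alpha_1(\|x\|)\le V(x)\le\alpha_2(\|x\|)$ and $\nabla V(x)\dot x\le-\alpha_3(\|x\|)+\gamma(\|d\|)$. In the present setting $d$ is the measurement error $e$. A function $f:\mathbb R_{\ge0}\to\mathbb R_{\ge0}$ is class $K_\infty$ if it is continuous,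 strictly increasing, $f(0)=0$ and $f(s)\to\infty$ as $s\to\infty$. *)

theory Defs
  imports "HOL-Analysis.Analysis"
begin

section \<open>Matrices\<close>

definition pos_def :: "real^'n^'n \<Rightarrow> bool"
  where "pos_def M \<longleftrightarrow> transpose M = M \<and> (\<forall>x. x \<noteq> 0 \<longrightarrow> 0 < x \<bullet> (M *v x))"

definition loewner_le :: "real^'n^'n \<Rightarrow> real^'n^'n \<Rightarrow> bool"
  where "loewner_le M N \<longleftrightarrow> (\<forall>x. x \<bullet> (M *v x) \<le> x \<bullet> (N *v x))"

definition lambda_min :: "real^'n^'n \<Rightarrow> real"
  where "lambda_min M = Min {l. \<exists>v. v \<noteq> 0 \<and> M *v v = l *\<^sub>R v}"

definition mat_norm :: "real^'n^'m \<Rightarrow> real"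
  where "mat_norm M = onorm ((*v) M)"

text \<open>This is the pseudo-inverse only for \<open>B\<close> of full column rank.\<close>

definition pinv :: "real^'m^'n \<Rightarrow> real^'n^'m"
  where "pinv B = matrix_inv (transpose B ** B) ** transpose B"

text \<open>The projection onto the orthogonal complement of the range of \<open>B\<close>.\<close>

definition unmatched_proj :: "real^'m^'n \<Rightarrow> real^'n^'n"
  where "unmatched_proj B = mat 1 - B ** pinv B"


section \<open>The auxiliary optimal control problem\<close>

text \<open>
  The system is \<open>x' = A x + B u + C v\<close> under the feedback \<open>u = K x\<close>, \<open>v = L x\<close>. The cost takes
  values in \<^typ>\<open>ennreal\<close>, so that a feedback with a divergent cost integral has cost \<open>\<infinity>\<close>.
\<close>

definition feedback_trajectory ::
  "real^'n^'n \<Rightarrow> real^'m^'n \<Rightarrow> real^'k^'n \<Rightarrow> real^'n^'m \<Rightarrow> real^'n^'k \<Rightarrow> (real \<Rightarrow> real^'n) \<Rightarrow> bool"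
  where "feedback_trajectory A B C K L x \<longleftrightarrow>
    (\<forall>s\<ge>0. (x has_vector_derivative
        A *v x s + B *v (K *v x s) + C *v (L *v x s)) (at s within {0..}))"

definition lq_cost ::
  "real^'n^'n \<Rightarrow> real \<Rightarrow> real^'n^'m \<Rightarrow> real^'n^'k \<Rightarrow> (real \<Rightarrow> real^'n) \<Rightarrow> ennreal"
  where "lq_cost W \<rho> K L x =
    (\<integral>\<^sup>+ s \<in> {0..}. ennreal (x s \<bullet> (W *v x s) + (K *v x s) \<bullet> (K *v x s)
        + \<rho>\<^sup>2 * ((L *v x s) \<bullet> (L *v x s))) \<partial>lborel)"

definition optimal_gains ::
  "real^'n^'n \<Rightarrow> real^'m^'n \<Rightarrow> real^'k^'n \<Rightarrow> real^'n^'n \<Rightarrow> real \<Rightarrow> real^'n^'m \<Rightarrow> real^'n^'k \<Rightarrow> bool"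
  where "optimal_gains A B C W \<rho> K L \<longleftrightarrow>
    (\<forall>K' L' x y. feedback_trajectory A B C K L x \<longrightarrow> feedback_trajectory A B C K' L' y \<longrightarrow>
       x 0 = y 0 \<longrightarrow> lq_cost W \<rho> K L x \<le> lq_cost W \<rho> K' L' y)"


section \<open>The event-triggered system\<close>

text \<open>
  Right-hand side of the closed loop as a function of the state \<open>x\<close> and the measurement error \<open>e\<close>;
  \<open>A0\<close> is the nominal system matrix and \<open>Ap\<close> the actual one.
\<close>

definition closed_loop ::
  "real^'n^'n \<Rightarrow> real^'n^'n \<Rightarrow> real^'m^'n \<Rightarrow> real \<Rightarrow> real^'n^'m \<Rightarrow> real^'n^'n
    \<Rightarrow> real^'n \<Rightarrow> real^'n \<Rightarrow> real^'n"
  where "closed_loop A0 Ap B \<alpha> K L x e =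
    A0 *v x + B *v (K *v (x + e))
    + \<alpha> *\<^sub>R (unmatched_proj B *v (L *v (x + e)))
    + (B ** pinv B) *v ((Ap - A0) *v x)
    + unmatched_proj B *v ((Ap - A0) *v x)
    - \<alpha> *\<^sub>R (unmatched_proj B *v (L *v (x + e)))"

definition measurement_error :: "(real \<Rightarrow> real^'n) \<Rightarrow> real \<Rightarrow> real \<Rightarrow> real^'n"
  where "measurement_error x \<tau> s = x \<tau> - x s"

lemma closed_loop_held_input:
  "closed_loop A0 Ap B \<alpha> K L (x s) (measurement_error x \<tau> s) = Ap *v x s + B *v (K *v x \<tau>)"
  by (simp add: closed_loop_def measurement_error_def unmatched_proj_def
      matrix_vector_mult_diff_rdistrib matrix_vector_mult_add_rdistrib)

text \<open>
  Event instants are extended reals: if no further event occurs, the infimum is taken over the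
  empty set, \<open>t (Suc k) = \<infinity>\<close>, and the input is held forever. In the triggering condition that
  determines \<open>t (Suc k)\<close>, the error refers to the latest sample \<open>x (t k)\<close>, also at the event
  instant itself (before the error is reset to 0).
\<close>

definition event_triggered_solution ::
  "(real^'n \<Rightarrow> real^'n \<Rightarrow> real^'n) \<Rightarrow> real \<Rightarrow> (real \<Rightarrow> real^'n) \<Rightarrow> (nat \<Rightarrow> ereal) \<Rightarrow> bool"
  where "event_triggered_solution f \<mu> x t \<longleftrightarrow>
    continuous_on {0..} x \<and>
    t 0 = 0 \<and>
    (\<forall>k. t (Suc k) = Inf {ereal s | s. t k < ereal s \<and>
        \<mu> * norm (x s) - norm (measurement_error x (real_of_ereal (t k)) s) \<le> 0}) \<and>
    (\<forall>k s. t k \<le> ereal s \<and> ereal s < t (Suc k) \<longrightarrow>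
        (x has_vector_derivative f (x s) (measurement_error x (real_of_ereal (t k)) s))
          (at s within {r. t k \<le> ereal r \<and> ereal r < t (Suc k)}))"


section \<open>Input-to-state stability\<close>

definition K_infinity :: "(real \<Rightarrow> real) \<Rightarrow> bool"
  where "K_infinity g \<longleftrightarrow> continuous_on {0..} g \<and> strict_mono_on {0..} g \<and> g 0 = 0 \<and>
    filterlim g at_top at_top"

text \<open>The system is \<open>x' = f x d\<close> with input \<open>d\<close>.\<close>

definition ISS_Lyapunov_function ::
  "(real^'n \<Rightarrow> real^'d \<Rightarrow> real^'n) \<Rightarrow> (real^'n \<Rightarrow> real) \<Rightarrow> bool"
  where "ISS_Lyapunov_function f V \<longleftrightarrow>
    (\<exists>grad \<alpha>1 \<alpha>2 \<alpha>3 \<gamma>.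
       K_infinity \<alpha>1 \<and> K_infinity \<alpha>2 \<and> K_infinity \<alpha>3 \<and> K_infinity \<gamma> \<and>
       (\<forall>x. GDERIV V x :> grad x) \<and>
       (\<forall>x d. \<alpha>1 (norm x) \<le> V x \<and> V x \<le> \<alpha>2 (norm x) \<and>
          grad x \<bullet> f x d \<le> - \<alpha>3 (norm x) + \<gamma> (norm d)))"

definition ISS :: "(real^'n \<Rightarrow> real^'d \<Rightarrow> real^'n) \<Rightarrow> bool"
  where "ISS f \<longleftrightarrow> (\<exists>V. ISS_Lyapunov_function f V)"

end

theory Submission
  imports Defs
begin

text \<open>
  The Lyapunov function is the value function \<open>V x = x \<bullet> S x\<close> of the auxiliary optimal control
  problem. Write \<open>D = A p - A p0\<close> for the uncertainty, \<open>R = I - B B\<^sup>+\<close> for the projection, and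
  \<open>u = K2 x\<close>, \<open>v = L x\<close>. Since \<open>S\<close> and \<open>R\<close> are symmetric, the definitions of the gains say that
  \<open>B\<^sup>T S x = - u\<close> and \<open>R S x = - (\<rho>\<^sup>2 / \<alpha>) v\<close>, so that in the derivative of \<open>V\<close> everything that
  enters through the range of \<open>B\<close> is paired with \<open>u\<close>, and everything that enters through the range of
  \<open>R\<close> with \<open>v\<close>.

  The Riccati equation turns the nominal drift into
  \<open>- x \<bullet> (Fu + \<rho>\<^sup>2 H + \<beta>\<^sup>2 I) x + \<parallel>u\<parallel>\<^sup>2 + \<rho>\<^sup>2 \<parallel>v\<parallel>\<^sup>2\<close>, and the input contributes
  \<open>- 2 \<parallel>u\<parallel>\<^sup>2\<close>. The uncertainty splits as \<open>D = B B\<^sup>+ D + R D\<close>: by Young's inequality its matched part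
  costs at most \<open>\<parallel>u\<parallel>\<^sup>2 + \<parallel>B\<^sup>+ D x\<parallel>\<^sup>2\<close> and its unmatched part at most
  \<open>\<rho>\<^sup>2 \<parallel>v\<parallel>\<^sup>2 + (\<rho>\<^sup>2 / \<alpha>\<^sup>2) \<parallel>D x\<parallel>\<^sup>2\<close>. The bounds \<open>Fu\<close> and \<open>H\<close>, which were put into the cost for this
  purpose, absorb the second summands, and what is left is
  \<open>- \<beta>\<^sup>2 \<parallel>x\<parallel>\<^sup>2 + 2 \<rho>\<^sup>2 \<parallel>v\<parallel>\<^sup>2 = - x \<bullet> Q2 x\<close> (lemma \<open>riccati_dissipation\<close>).

  The measurement error adds the cross term \<open>2 (S x) \<bullet> B K2 e\<close>, which is linear in \<open>x\<close> and is
  therefore dominated by half of the quadratic decay plus a multiple of \<open>\<parallel>e\<parallel>\<^sup>2\<close> (lemma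
  \<open>quadratic_ISS_Lyapunov_function\<close>). All comparison functions are multiples of \<open>r\<^sup>2\<close>.
\<close>

section \<open>Quadratic forms\<close>

text \<open>
  Adjoints are moved across inner products in the form \<open>transpose M *v x\<close>, which rewriting to \<open>x v* M\<close>
  would destroy.
\<close>

declare transpose_matrix_vector [simp del]

lemma matrix_vector_mult_uminus: "(- M) *v x = - (M *v x)" for M :: "'a::ring_1^'n^'m"
  by (simp add: matrix_vector_mult_def vec_eq_iff sum_negf)

lemma inner_matrix_vector_transpose:
  fixes M :: "real^'n^'m"
  shows "x \<bullet> (M *v y) = (transpose M *v x) \<bullet> y"
  by (simp add: transpose_matrix_vector dot_lmul_matrix)

lemma transpose_diff: "transpose (M - N) = transpose M - transpose N"
  for M N :: "'a::ab_group_add^'n^'m"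
  by (simp add: transpose_def vec_eq_iff)

text \<open>The quadratic form attains its minimum on the compact unit sphere; scale from there.\<close>

lemma pos_def_coercive:
  fixes M :: "real^'n^'n"
  assumes "pos_def M"
  obtains c where "c > 0" "\<And>x. c * (norm x)\<^sup>2 \<le> x \<bullet> (M *v x)"
proof -
  let ?q = "\<lambda>x. x \<bullet> (M *v x)"
  have "continuous_on (sphere 0 1) ?q"
    by (intro continuous_on_inner continuous_on_id linear_continuous_on) simp
  moreover have "sphere (0::real^'n) 1 \<noteq> {}"
    by simp
  ultimately obtain z where z: "z \<in> sphere 0 1" and min: "\<And>y. y \<in> sphere 0 1 \<Longrightarrow> ?q z \<le> ?q y"
    using continuous_attains_inf[of "sphere 0 1" ?q] by (metis compact_sphere)
  from z have "z \<noteq> 0"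
    by auto
  with assms have "?q z > 0"
    by (simp add: pos_def_def)
  moreover have "?q z * (norm x)\<^sup>2 \<le> ?q x" for x
  proof (cases "x = 0")
    case False
    have "?q z \<le> ?q ((1 / norm x) *\<^sub>R x)"
      using False by (intro min) simp
    also have "\<dots> = ?q x / (norm x)\<^sup>2"
      by (simp add: matrix_vector_mult_scaleR power2_eq_square)
    finally show ?thesis
      using False by (simp add: field_simps)
  qed simp
  ultimately show thesis
    using that by blast
qed

lemma quadratic_form_upper_bound:
  fixes M :: "real^'n^'n"
  shows "x \<bullet> (M *v x) \<le> onorm ((*v) M) * (norm x)\<^sup>2"
proof -
  have "x \<bullet> (M *v x) \<le> norm x * norm (M *v x)"
    by (rule norm_cauchy_schwarz)
  also have "\<dots> \<le> norm x * (onorm ((*v) M) * norm x)"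
    by (intro mult_left_mono onorm) auto
  finally show ?thesis
    by (simp add: power2_eq_square mult_ac)
qed

lemma GDERIV_quadratic_form:
  fixes S :: "real^'n^'n"
  assumes "transpose S = S"
  shows "GDERIV (\<lambda>x. x \<bullet> (S *v x)) x :> 2 *\<^sub>R (S *v x)"
proof -
  have "((\<lambda>x. x \<bullet> (S *v x)) has_derivative (\<lambda>h. x \<bullet> (S *v h) + h \<bullet> (S *v x))) (at x)"
    by (intro has_derivative_inner has_derivative_ident bounded_linear_imp_has_derivative) simp
  moreover have "x \<bullet> (S *v h) + h \<bullet> (S *v x) = h \<bullet> (2 *\<^sub>R (S *v x))" for h
    using inner_matrix_vector_transpose[of x S h] assms by (simp add: inner_commute)
  ultimately show ?thesis
    by (simp add: gderiv_def)
qed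

lemma K_infinity_quadratic:
  assumes "c > 0"
  shows "K_infinity (\<lambda>r. c * r\<^sup>2)"
  unfolding K_infinity_def
proof (intro conjI)
  show "continuous_on {0..} (\<lambda>r. c * r\<^sup>2)"
    by (intro continuous_intros)
  show "strict_mono_on {0..} (\<lambda>r. c * r\<^sup>2)"
    using assms by (auto intro!: strict_mono_onI power_strict_mono)
  show "filterlim (\<lambda>r. c * r\<^sup>2) at_top at_top"
    using assms by (intro filterlim_tendsto_pos_mult_at_top[OF tendsto_const]
        filterlim_pow_at_top filterlim_ident) auto
qed simp


section \<open>Input-to-state stability from a quadratic dissipation inequality\<close>

text \<open>
  With \<open>q\<close> a coercivity constant of \<open>Q\<close> and \<open>c\<close> a bound for the cross term, completing the square in
  \<open>- q \<parallel>x\<parallel>\<^sup>2 + 2 c \<parallel>x\<parallel> \<parallel>d\<parallel>\<close> leaves the decay \<open>q \<parallel>x\<parallel>\<^sup>2 / 2\<close> and the gain \<open>(2 c\<^sup>2 / q) \<parallel>d\<parallel>\<^sup>2\<close>.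
\<close>

lemma quadratic_ISS_Lyapunov_function:
  fixes S Q :: "real^'n^'n" and E :: "real^'d^'n" and f :: "real^'n \<Rightarrow> real^'d \<Rightarrow> real^'n"
  assumes S: "pos_def S" and Q: "pos_def Q"
    and diss: "\<And>x d. 2 * ((S *v x) \<bullet> f x d) \<le> - (x \<bullet> (Q *v x)) + 2 * (x \<bullet> (E *v d))"
  shows "ISS_Lyapunov_function f (\<lambda>x. x \<bullet> (S *v x))"
proof -
  obtain s where s: "s > 0" "\<And>x. s * (norm x)\<^sup>2 \<le> x \<bullet> (S *v x)"
    using pos_def_coercive[OF S] by blast
  obtain q where q: "q > 0" "\<And>x. q * (norm x)\<^sup>2 \<le> x \<bullet> (Q *v x)"
    using pos_def_coercive[OF Q] by blast
  \<comment> \<open>Adding 1 makes the constants positive, as a function of class \<open>K\<^sub>\<infinity>\<close> requires, also if \<open>E = 0\<close>.\<close>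
  define b where "b = onorm ((*v) S) + 1"
  define c where "c = onorm ((*v) E) + 1"
  have "b > 0" "c > 0"
    using onorm_pos_le[of "(*v) S"] onorm_pos_le[of "(*v) E"] by (simp_all add: b_def c_def)
  have upper: "x \<bullet> (S *v x) \<le> b * (norm x)\<^sup>2" for x
    using quadratic_form_upper_bound[of x S] by (simp add: b_def algebra_simps add_increasing)
  have cross: "x \<bullet> (E *v d) \<le> c * (norm x * norm d)" for x d
  proof -
    have "x \<bullet> (E *v d) \<le> norm x * norm (E *v d)"
      by (rule norm_cauchy_schwarz)
    also have "\<dots> \<le> norm x * (onorm ((*v) E) * norm d)"
      by (intro mult_left_mono onorm) auto
    finally show ?thesis
      by (simp add: c_def algebra_simps add_increasing)
  qed
  have decay: "(2 *\<^sub>R (S *v x)) \<bullet> f x d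
      \<le> - (q / 2 * (norm x)\<^sup>2) + 2 * c\<^sup>2 / q * (norm d)\<^sup>2" for x d
  proof -
    have "0 \<le> (q * norm x - 2 * c * norm d)\<^sup>2 / (2 * q)"
      using \<open>q > 0\<close> by simp
    also have "\<dots> = q / 2 * (norm x)\<^sup>2 - 2 * (c * (norm x * norm d)) + 2 * c\<^sup>2 / q * (norm d)\<^sup>2"
      using \<open>q > 0\<close> by (simp add: power2_eq_square field_simps)
    finally show ?thesis
      using diss[of x d] q(2)[of x] cross[of x d] by (simp add: field_simps)
  qed
  show ?thesis
    unfolding ISS_Lyapunov_function_def
  proof (rule exI[of _ "\<lambda>x. 2 *\<^sub>R (S *v x)"], rule exI[of _ "\<lambda>r. s * r\<^sup>2"],
      rule exI[of _ "\<lambda>r. b * r\<^sup>2"], rule exI[of _ "\<lambda>r. q / 2 * r\<^sup>2"],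
      rule exI[of _ "\<lambda>r. 2 * c\<^sup>2 / q * r\<^sup>2"], intro conjI allI)
    show "GDERIV (\<lambda>x. x \<bullet> (S *v x)) x :> 2 *\<^sub>R (S *v x)" for x
      using S by (intro GDERIV_quadratic_form) (simp add: pos_def_def)
  qed (simp_all only: s(2) upper decay K_infinity_quadratic \<open>s > 0\<close> \<open>q > 0\<close> \<open>b > 0\<close> \<open>c > 0\<close>
      half_gt_zero divide_pos_pos mult_pos_pos zero_less_power zero_less_numeral)
qed


section \<open>The projection onto the unmatched directions\<close>

text \<open>Full column rank makes the Gram matrix \<open>B\<^sup>T B\<close> injective, because \<open>z \<bullet> B\<^sup>T B z = \<parallel>B z\<parallel>\<^sup>2\<close>.\<close>

lemma invertible_gram_matrix:
  fixes B :: "real^'m^'n"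
  assumes "rank B = CARD('m)"
  shows "invertible (transpose B ** B)"
proof -
  have inj: "inj ((*v) B)"
    using assms by (simp add: full_rank_injective)
  have "z = 0" if "(transpose B ** B) *v z = 0" for z
  proof -
    have "(B *v z) \<bullet> (B *v z) = z \<bullet> ((transpose B ** B) *v z)"
      by (simp add: inner_matrix_vector_transpose[of z "transpose B"]
          matrix_vector_mul_assoc[symmetric] del: inner_eq_zero_iff)
    with that have "B *v z = B *v 0"
      by simp
    with inj show ?thesis
      by (simp only: inj_eq)
  qed
  then show ?thesis
    by (metis matrix_left_invertible_ker invertible_left_inverse)
qed

lemma transpose_unmatched_proj:
  fixes B :: "real^'m^'n"
  assumes "rank B = CARD('m)"
  shows "transpose (unmatched_proj B) = unmatched_proj B"
proof -
  let ?G = "transpose B ** B"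
  have "transpose ?G = ?G"
    by (simp add: matrix_transpose_mul)
  moreover have inv: "?G ** matrix_inv ?G = mat 1" "matrix_inv ?G ** ?G = mat 1"
    using someI_ex[OF invertible_gram_matrix[OF assms, unfolded invertible_def]]
    unfolding matrix_inv_def by blast+
  \<comment> \<open>The transposed inverse is a left inverse too, because the Gram matrix is symmetric.\<close>
  ultimately have "transpose (matrix_inv ?G) ** ?G = mat 1"
    by (metis matrix_transpose_mul transpose_mat)
  then have "transpose (matrix_inv ?G) = matrix_inv ?G"
    by (metis inv(1) matrix_mul_assoc matrix_mul_lid matrix_mul_rid)
  then show ?thesis
    by (simp add: unmatched_proj_def pinv_def transpose_diff matrix_transpose_mul
        matrix_mul_assoc)
qed


section \<open>Dissipation along the closed loop\<close>

text \<open>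
  The heart of the proof: \<open>D\<close> is the uncertainty, \<open>C\<close> the pseudo-inverse and \<open>R\<close> the projection. The
  splitting \<open>D = B C D + R D\<close> pairs the matched part of the uncertainty with the input \<open>u = K x\<close> and
  the unmatched part with the auxiliary input \<open>v = L x\<close>. The Riccati equation contributes \<open>\<parallel>u\<parallel>\<^sup>2\<close> and
  \<open>\<rho>\<^sup>2 \<parallel>v\<parallel>\<^sup>2\<close>, and Young's inequality contributes the same amounts again. The feedback \<open>B u\<close> pays
  for both terms in \<open>u\<close>; but \<open>v\<close> is not applied to the true system, and so \<open>2 \<rho>\<^sup>2 \<parallel>v\<parallel>\<^sup>2\<close> remains and
  has to be subtracted from the decay \<open>\<beta>\<^sup>2 \<parallel>x\<parallel>\<^sup>2\<close>.
\<close>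

lemma riccati_dissipation:
  fixes A0 D Fu H S R L :: "real^'n^'n" and B :: "real^'m^'n" and C K :: "real^'n^'m"
    and \<alpha> \<beta> \<rho> :: real
  assumes "\<alpha> > 0" and "\<rho> \<noteq> 0"
    and S: "transpose S = S" and R: "transpose R = R" and split: "mat 1 = B ** C + R"
    and Fu: "loewner_le (transpose D ** transpose C ** C ** D) Fu"
    and H: "loewner_le ((1 / \<alpha>\<^sup>2) *\<^sub>R (transpose D ** D)) H"
    and K: "K = - (transpose B ** S)"
    and L: "L = - ((\<alpha> / \<rho>\<^sup>2) *\<^sub>R (R ** S))"
    and riccati: "S ** A0 + transpose A0 ** S + Fu + \<rho>\<^sup>2 *\<^sub>R H + \<beta>\<^sup>2 *\<^sub>R mat 1
      - S ** (B ** transpose B + (\<alpha>\<^sup>2 / \<rho>\<^sup>2) *\<^sub>R (R ** R)) ** S = 0"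
  shows "2 * ((S *v x) \<bullet> ((A0 + D) *v x + B *v (K *v x)))
    \<le> - (x \<bullet> ((\<beta>\<^sup>2 *\<^sub>R mat 1 - (2 * \<rho>\<^sup>2) *\<^sub>R (transpose L ** L)) *v x))"
proof -
  define y where "y = S *v x"
  define u where "u = K *v x"
  define v where "v = L *v x"
  define w where "w = C *v (D *v x)"
  define z where "z = D *v x"
  have u: "transpose B *v y = - u"
    by (simp add: u_def K y_def matrix_vector_mul_assoc matrix_vector_mult_uminus)
  have v: "R *v y = - ((\<rho>\<^sup>2 / \<alpha>) *\<^sub>R v)"
    using \<open>\<alpha> > 0\<close> \<open>\<rho> \<noteq> 0\<close>
    by (simp add: v_def L y_def matrix_vector_mul_assoc matrix_vector_mult_uminus
        scaleR_matrix_vector_assoc[symmetric])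
  have yB: "y \<bullet> (B *v a) = - (u \<bullet> a)" for a
    by (simp add: inner_matrix_vector_transpose u)
  have yR: "y \<bullet> (R *v a) = - (\<rho>\<^sup>2 / \<alpha> * (v \<bullet> a))" for a
    by (simp add: inner_matrix_vector_transpose R v)
  have xS: "x \<bullet> (S *v a) = y \<bullet> a" for a
    by (simp add: inner_matrix_vector_transpose S y_def)
  have drift: "2 * (y \<bullet> (A0 *v x)) = - (x \<bullet> (Fu *v x)) - \<rho>\<^sup>2 * (x \<bullet> (H *v x))
      - \<beta>\<^sup>2 * (x \<bullet> x) + u \<bullet> u + \<rho>\<^sup>2 * (v \<bullet> v)"
  proof -
    have "0 = x \<bullet> ((S ** A0 + transpose A0 ** S + Fu + \<rho>\<^sup>2 *\<^sub>R H + \<beta>\<^sup>2 *\<^sub>R mat 1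
      - S ** (B ** transpose B + (\<alpha>\<^sup>2 / \<rho>\<^sup>2) *\<^sub>R (R ** R)) ** S) *v x)"
      by (simp add: riccati)
    also have "\<dots> = y \<bullet> (A0 *v x) + (A0 *v x) \<bullet> y + x \<bullet> (Fu *v x) + \<rho>\<^sup>2 * (x \<bullet> (H *v x))
        + \<beta>\<^sup>2 * (x \<bullet> x) - y \<bullet> (B *v (transpose B *v y))
        - \<alpha>\<^sup>2 / \<rho>\<^sup>2 * (y \<bullet> (R *v (R *v y)))"
      by (simp add: matrix_vector_mult_add_rdistrib matrix_vector_mult_diff_rdistrib
          matrix_vector_mul_assoc[symmetric] scaleR_matrix_vector_assoc[symmetric]
          inner_add_right inner_diff_right xS y_def[symmetric]
          inner_matrix_vector_transpose[of x "transpose A0"])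
    also have "y \<bullet> (B *v (transpose B *v y)) = u \<bullet> u"
      by (simp add: yB u)
    also have "\<alpha>\<^sup>2 / \<rho>\<^sup>2 * (y \<bullet> (R *v (R *v y))) = \<rho>\<^sup>2 * (v \<bullet> v)"
      using \<open>\<alpha> > 0\<close> \<open>\<rho> \<noteq> 0\<close> by (simp add: yR v field_simps power2_eq_square)
    finally show ?thesis
      by (simp add: inner_commute)
  qed
  have "z = B *v w + R *v z"
    using arg_cong[OF split, of "\<lambda>M. M *v z"]
    by (simp add: matrix_vector_mult_add_rdistrib matrix_vector_mul_assoc[symmetric] w_def z_def)
  then have "y \<bullet> z = y \<bullet> (B *v w) + y \<bullet> (R *v z)"
    by (metis inner_add_right)
  then have uncertainty: "2 * (y \<bullet> z) = - 2 * (u \<bullet> w) - 2 * (\<rho>\<^sup>2 / \<alpha> * (v \<bullet> z))"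
    by (simp add: yB yR)
  \<comment> \<open>Young's inequality, weighted in the unmatched part so that \<open>v\<close> carries exactly \<open>\<rho>\<^sup>2\<close>.\<close>
  have matched: "- 2 * (u \<bullet> w) \<le> u \<bullet> u + w \<bullet> w"
    using inner_ge_zero[of "u + w"] by (simp add: inner_simps inner_commute)
  have unmatched: "- 2 * (\<rho>\<^sup>2 / \<alpha> * (v \<bullet> z)) \<le> \<rho>\<^sup>2 * (v \<bullet> v) + \<rho>\<^sup>2 * (1 / \<alpha>\<^sup>2 * (z \<bullet> z))"
  proof -
    have "0 \<le> \<rho>\<^sup>2 * ((v + (1 / \<alpha>) *\<^sub>R z) \<bullet> (v + (1 / \<alpha>) *\<^sub>R z))"
      by simp
    then show ?thesis
      by (simp add: inner_simps inner_commute power2_eq_square algebra_simps)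
  qed
  have "x \<bullet> ((transpose D ** transpose C ** C ** D) *v x) = w \<bullet> w"
    by (simp add: matrix_vector_mul_assoc[symmetric] w_def
        inner_matrix_vector_transpose[of _ "transpose D"]
        inner_matrix_vector_transpose[of _ "transpose C"])
  with Fu have w: "w \<bullet> w \<le> x \<bullet> (Fu *v x)"
    unfolding loewner_le_def by metis
  have "x \<bullet> (((1 / \<alpha>\<^sup>2) *\<^sub>R (transpose D ** D)) *v x) = 1 / \<alpha>\<^sup>2 * (z \<bullet> z)"
    by (simp add: matrix_vector_mul_assoc[symmetric] scaleR_matrix_vector_assoc[symmetric] z_def
        inner_matrix_vector_transpose[of _ "transpose D"])
  with H have "1 / \<alpha>\<^sup>2 * (z \<bullet> z) \<le> x \<bullet> (H *v x)"
    unfolding loewner_le_def by metis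
  then have z: "\<rho>\<^sup>2 * (1 / \<alpha>\<^sup>2 * (z \<bullet> z)) \<le> \<rho>\<^sup>2 * (x \<bullet> (H *v x))"
    by (intro mult_left_mono) auto
  have "2 * ((S *v x) \<bullet> ((A0 + D) *v x + B *v (K *v x)))
      = 2 * (y \<bullet> (A0 *v x)) + 2 * (y \<bullet> z) - 2 * (u \<bullet> u)"
    by (simp add: y_def[symmetric] u_def[symmetric] matrix_vector_mult_add_rdistrib
        inner_add_right yB z_def)
  also have "\<dots> \<le> - (\<beta>\<^sup>2 * (x \<bullet> x)) + 2 * \<rho>\<^sup>2 * (v \<bullet> v)"
    using drift uncertainty matched unmatched w z by linarith
  also have "\<dots> = - (x \<bullet> ((\<beta>\<^sup>2 *\<^sub>R mat 1 - (2 * \<rho>\<^sup>2) *\<^sub>R (transpose L ** L)) *v x))"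
    by (simp add: matrix_vector_mult_diff_rdistrib matrix_vector_mul_assoc[symmetric]
        scaleR_matrix_vector_assoc[symmetric] inner_diff_right v_def
        inner_matrix_vector_transpose[of _ "transpose L"])
  finally show ?thesis .
qed

text \<open>The two auxiliary input terms cancel, so the error acts through \<open>B K\<close> alone.\<close>

lemma closed_loop_eq:
  "closed_loop A0 Ap B \<alpha> K L x e = (Ap *v x + B *v (K *v x)) + (B ** K) *v e"
  by (simp add: closed_loop_def unmatched_proj_def matrix_vector_mult_diff_rdistrib
      matrix_vector_right_distrib matrix_vector_mul_assoc)

theorem theorem2:
  fixes A :: "real^'q \<Rightarrow> real^'n^'n" and B :: "real^'m^'n"
    and P :: "(real^'q) set" and p0 p :: "real^'q"
    and Fu H S Q2 :: "real^'n^'n" and K2 :: "real^'n^'m" and L :: "real^'n^'n"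
    and \<alpha> \<rho> \<beta> \<sigma> \<mu>2 :: real
    and x :: "real \<Rightarrow> real^'n" and t :: "nat \<Rightarrow> ereal"
  assumes "rank B = CARD('m)"
    and "\<alpha> > 0" and "\<rho> \<noteq> 0"
    and "pos_def Fu" and "pos_def H"
    and "\<forall>q\<in>P. loewner_le
          (transpose (A q - A p0) ** transpose (pinv B) ** pinv B ** (A q - A p0)) Fu"
    and "\<forall>q\<in>P. loewner_le
          ((1 / \<alpha>\<^sup>2) *\<^sub>R (transpose (A q - A p0) ** (A q - A p0))) H"
    and "0 < \<sigma>" and "\<sigma> < 1"
    and "p \<in> P"
    and "optimal_gains (A p0) B (\<alpha> *\<^sub>R unmatched_proj B)
          (Fu + \<rho>\<^sup>2 *\<^sub>R H + \<beta>\<^sup>2 *\<^sub>R mat 1) \<rho> K2 L"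
    and "K2 = - (transpose B ** S)"
    and "L = - ((\<alpha> / \<rho>\<^sup>2) *\<^sub>R (unmatched_proj B ** S))"
    and "pos_def S"
    and "S ** A p0 + transpose (A p0) ** S + Fu + \<rho>\<^sup>2 *\<^sub>R H + \<beta>\<^sup>2 *\<^sub>R mat 1
          - S ** (B ** transpose B
                  + (\<alpha>\<^sup>2 / \<rho>\<^sup>2) *\<^sub>R (unmatched_proj B ** unmatched_proj B)) ** S = 0"
    and "Q2 = \<beta>\<^sup>2 *\<^sub>R mat 1 - (2 * \<rho>\<^sup>2) *\<^sub>R (transpose L ** L)"
    and "pos_def Q2"
    and "S ** B ** K2 \<noteq> 0"
    and "\<mu>2 = \<sigma> * lambda_min Q2 / (2 * mat_norm (S ** B ** K2))"
    and "event_triggered_solution (closed_loop (A p0) (A p) B \<alpha> K2 L) \<mu>2 x t"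
  shows "ISS (closed_loop (A p0) (A p) B \<alpha> K2 L)"
proof -
  have S: "transpose S = S"
    using \<open>pos_def S\<close> by (simp add: pos_def_def)
  have "A p = A p0 + (A p - A p0)"
    by simp
  moreover have "mat 1 = B ** pinv B + unmatched_proj B"
    by (simp add: unmatched_proj_def)
  ultimately have undisturbed:
    "2 * ((S *v z) \<bullet> (A p *v z + B *v (K2 *v z))) \<le> - (z \<bullet> (Q2 *v z))" for z
    using riccati_dissipation[OF \<open>\<alpha> > 0\<close> \<open>\<rho> \<noteq> 0\<close> S transpose_unmatched_proj[OF assms(1)], of B
        "pinv B" "A p - A p0" Fu H K2 L "A p0" \<beta> z] assms
    by metis
  have "2 * ((S *v z) \<bullet> closed_loop (A p0) (A p) B \<alpha> K2 L z e)
      \<le> - (z \<bullet> (Q2 *v z)) + 2 * (z \<bullet> ((S ** B ** K2) *v e))" for z e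
    using undisturbed[of z] inner_matrix_vector_transpose[of z S "(B ** K2) *v e"]
    by (simp add: closed_loop_eq inner_add_right S matrix_vector_mul_assoc matrix_mul_assoc)
  then show ?thesis
    unfolding ISS_def
    using quadratic_ISS_Lyapunov_function[OF \<open>pos_def S\<close> \<open>pos_def Q2\<close>] by blast
qed

end
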